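(* Let $S$ be a $*$-monoid and let $a,b,c\in S$ satisfy $(ab)^{*}=ab$ and $(ac)^{*}=ac$. Then the following conditions are equivalent: (1) $a$ is both $(b,c)$-invertible and $(c,b)$-invertible, and $b$ and $c$ are both group invertible in $S$; (2) $ba$ is $(c,b)$-invertible and $ca$ is $(b,c)$-invertible.
   Context: A $*$-monoid is a monoid $S$ with an involution, i.e. a map $*:S\to S$ with $(a^{*})^{*}=a$ and $(ab)^{*}=b^{*}a^{*}$ for all $a,b\in S$. For $a,b,c\in S$: $a$ is $(b,c)$-invertible if there exists $y\in S$ with $y\in bSy\cap ySc$, $yab=b$, $cay=c$. The notions with $(c,b)$, or applied to other elements in place of $a$, are obtained by substitution. An element $a\in S$ is group invertible if there is $x\in S$ with $axa=a$, $xax=x$, $ax=xa$. *)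

theory Defs
  imports Main
begin

class star_monoid = monoid_mult +
  fixes star :: "'a \<Rightarrow> 'a"
  assumes star_star: "star (star a) = a"
    and star_mult: "star (a * b) = star b * star a"

definition bc_invertible :: "'a::monoid_mult \<Rightarrow> 'a \<Rightarrow> 'a \<Rightarrow> bool"
  where "bc_invertible b c a \<longleftrightarrow>
    (\<exists>y. y \<in> {b * s * y |s. True} \<inter> {y * s * c |s. True} \<and> y * a * b = b \<and> c * a * y = c)"

definition group_invertible :: "'a::monoid_mult \<Rightarrow> bool"
  where "group_invertible a \<longleftrightarrow> (\<exists>x. a * x * a = a \<and> x * a * x = x \<and> a * x = x * a)"

end

theory Submission
  imports Defs
begin

text \<open>
  Invertibility of \<open>a\<close> along \<open>(b, c)\<close> amounts to the divisibility conditions \<open>b \<in> S c a b\<close> and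
  \<open>c \<in> c a b S\<close>, and group invertibility of \<open>b\<close> to \<open>b \<in> S b\<^sup>2 \<inter> b\<^sup>2 S\<close>. Hence, once \<open>b\<close> and \<open>c\<close> are
  group invertible, a leading factor \<open>b\<close> or \<open>c\<close> may be doubled or halved freely in such conditions.
  In the direction from (2) to (1), \<open>b \<in> b\<^sup>2 S\<close> is immediate. For \<open>b \<in> S b\<^sup>2\<close> put \<open>e = a b\<close> and
  \<open>f = a c\<close>, so that \<open>S b = S e\<close> and \<open>S c = S f\<close>. Then \<open>e \<in> S c e = S f e\<close>, and as \<open>e\<close> and \<open>f\<close> are
  self-adjoint, \<open>e \<in> e f S\<close>; hence \<open>b = b f z\<close> for some \<open>z\<close>. Multiplying \<open>b f \<in> S b\<^sup>2 f\<close> by \<open>z\<close> on the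
  right gives the claim.
\<close>

text \<open>Both \<open>u * c\<close> and \<open>b * v\<close> equal
  \<open>u * c * a * b * v\<close>, and this common element is the inverse.\<close>

lemma bc_invertible_iff:
  fixes a b c :: "'a::monoid_mult"
  shows "bc_invertible b c a \<longleftrightarrow> (\<exists>u. b = u * c * a * b) \<and> (\<exists>v. c = c * a * b * v)"
proof
  assume "bc_invertible b c a"
  then obtain y s t where y: "y = b * s * y" "y = y * t * c" and "y * a * b = b" "c * a * y = c"
    unfolding bc_invertible_def by blast
  then have "b = (y * t) * c * a * b" "c = c * a * b * (s * y)"
    by (metis mult.assoc)+
  then show "(\<exists>u. b = u * c * a * b) \<and> (\<exists>v. c = c * a * b * v)"
    by blast
next
  assume "(\<exists>u. b = u * c * a * b) \<and> (\<exists>v. c = c * a * b * v)"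
  then obtain u v where u: "b = u * c * a * b" and v: "c = c * a * b * v"
    by blast
  define y where "y = b * v"
  have y_eq: "y = u * c"
    unfolding y_def by (metis u v mult.assoc)
  have yab: "y * a * b = b" and cay: "c * a * y = c"
    using u v by (simp_all add: y_eq) (simp add: y_eq[symmetric] y_def mult.assoc)
  have yay: "y * a * y = y"
    by (metis yab y_def mult.assoc)
  have "y = b * (v * a) * y" "y = y * (a * u) * c"
    using yay by (metis y_def mult.assoc, metis y_eq mult.assoc)
  then show "bc_invertible b c a"
    unfolding bc_invertible_def using yab cay by blast
qed

text \<open>Both \<open>u * a\<close> and \<open>a * v\<close> equal \<open>u * a * a * v\<close>.
  This element fixes \<open>a\<close> from either side, and \<open>u * a * v\<close> inverts
  \<open>a\<close> relative to it.\<close>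

lemma group_invertible_iff:
  fixes a :: "'a::monoid_mult"
  shows "group_invertible a \<longleftrightarrow> (\<exists>u. a = u * a * a) \<and> (\<exists>v. a = a * a * v)"
proof
  assume "group_invertible a"
  then obtain x where "a * x * a = a" "a * x = x * a"
    unfolding group_invertible_def by blast
  then have "a = x * a * a" "a = a * a * x"
    by (metis mult.assoc)+
  then show "(\<exists>u. a = u * a * a) \<and> (\<exists>v. a = a * a * v)"
    by blast
next
  assume "(\<exists>u. a = u * a * a) \<and> (\<exists>v. a = a * a * v)"
  then obtain u v where u: "a = u * a * a" and v: "a = a * a * v"
    by blast
  have ua: "u * a = a * v"
    by (metis u v mult.assoc)
  define x where "x = u * a * v"
  have ax: "a * x = a * v"
    unfolding x_def by (metis ua v mult.assoc)
  have xa: "x * a = a * v"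
    unfolding x_def by (metis ua u mult.assoc)
  have "a * x * a = a"
    by (metis ax ua u)
  moreover have "x * a * x = x"
    unfolding xa unfolding x_def by (metis ua v mult.assoc)
  ultimately show "group_invertible a"
    unfolding group_invertible_def using ax xa by metis
qed

lemma bc_invertible_mult_left:
  fixes a b c :: "'a::monoid_mult"
  assumes "bc_invertible c b a" and "group_invertible b"
  shows "bc_invertible c b (b * a)"
proof -
  obtain u v where u: "c = u * b * a * c" and v: "b = b * a * c * v"
    using assms(1) unfolding bc_invertible_iff by blast
  obtain x y where x: "b = x * b * b" and y: "b = b * b * y"
    using assms(2) unfolding group_invertible_iff by blast
  have "c = (u * x) * b * (b * a) * c"
    by (metis u x mult.assoc)
  moreover have "b = b * (b * a) * c * (v * y)"
    by (metis v y mult.assoc)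
  ultimately show ?thesis
    unfolding bc_invertible_iff by blast
qed

lemma bc_invertible_mult_left_cancel:
  fixes a b c :: "'a::monoid_mult"
  assumes "bc_invertible c b (b * a)" and "group_invertible b"
  shows "bc_invertible c b a"
proof -
  obtain u v where u: "c = u * b * (b * a) * c" and v: "b = b * (b * a) * c * v"
    using assms(1) unfolding bc_invertible_iff by blast
  obtain x where x: "b = x * b * b"
    using assms(2) unfolding group_invertible_iff by blast
  \<comment> \<open>Multiply \<open>v\<close> by \<open>x\<close> on the left and use
    \<open>x * b * b = b\<close>.\<close>
  have "x * b = b * a * c * v"
    by (metis v x mult.assoc)
  then have "b = b * a * c * (v * b)"
    by (metis x mult.assoc)
  moreover have "c = (u * b) * b * a * c"
    by (metis u mult.assoc)
  ultimately show ?thesis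
    unfolding bc_invertible_iff by blast
qed

lemma group_invertible_of_bc_invertible:
  fixes a b c :: "'a::star_monoid"
  assumes ab: "star (a * b) = a * b" and ac: "star (a * c) = a * c"
    and "bc_invertible c b (b * a)" and "bc_invertible b c (c * a)"
  shows "group_invertible b"
proof -
  obtain u w where u: "c = u * b * (b * a) * c" and w: "b = b * (b * a) * c * w"
    using assms(3) unfolding bc_invertible_iff by blast
  obtain p where p: "b = p * c * (c * a) * b"
    using assms(4) unfolding bc_invertible_iff by blast
  \<comment> \<open>\<open>h\<close> collects what precedes \<open>f\<close> once
    \<open>u * b * b * f\<close> replaces the second \<open>c\<close> in
    \<open>e = a * p * c * c * e\<close>.\<close>
  define e f h where "e = a * b" and "f = a * c" and "h = a * p * c * u * b * b"
  have b_eq: "b = p * c * c * e"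
    using p by (simp only: e_def mult.assoc)
  have c_eq: "c = u * b * b * f"
    using u by (simp only: f_def mult.assoc)
  have "e = a * p * c * c * e"
    using arg_cong[OF b_eq, of "\<lambda>x. a * x"] by (simp only: e_def mult.assoc)
  also have "\<dots> = a * p * c * (u * b * b * f) * e"
    unfolding c_eq[symmetric] ..
  also have "\<dots> = h * f * e"
    by (simp only: h_def mult.assoc)
  finally have hfe: "e = h * f * e" .
  have star_e: "star e = e" and star_f: "star f = f"
    using ab ac by (simp_all only: e_def f_def)
  have "e = star e"
    by (simp only: star_e)
  also have "\<dots> = star (h * f * e)"
    by (rule arg_cong[OF hfe])
  also have "\<dots> = e * f * star h"
    by (simp only: star_mult mult.assoc star_e star_f)
  finally have e_eq: "e = e * f * star h" .
  \<comment> \<open>Left multiplication by \<open>p * c * c\<close> carries the equation from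
    \<open>e\<close> over to \<open>b\<close>.\<close>
  have "p * c * c * e = p * c * c * (e * f * star h)"
    by (rule arg_cong[OF e_eq])
  also have "\<dots> = (p * c * c * e) * f * star h"
    by (simp only: mult.assoc)
  finally have bf: "b = b * f * star h"
    unfolding b_eq[symmetric] .
  also have "\<dots> = b * (a * (u * b * b * f)) * star h"
    unfolding c_eq[symmetric] unfolding f_def ..
  also have "\<dots> = (b * a * u) * b * (b * f * star h)"
    by (simp only: mult.assoc)
  also have "\<dots> = (b * a * u) * b * b"
    unfolding bf[symmetric] ..
  finally have "b = (b * a * u) * b * b" .
  moreover have "b = b * b * (a * c * w)"
    using w by (simp only: mult.assoc)
  ultimately show ?thesis
    unfolding group_invertible_iff by blast
qed

theorem theorem4p7:
  fixes a b c :: "'a::star_monoid"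
  assumes "star (a * b) = a * b"
    and "star (a * c) = a * c"
  shows "(bc_invertible b c a \<and> bc_invertible c b a \<and> group_invertible b \<and> group_invertible c)
    \<longleftrightarrow> (bc_invertible c b (b * a) \<and> bc_invertible b c (c * a))"
  using group_invertible_of_bc_invertible[OF assms]
    \<comment> \<open>Exchanging \<open>b\<close> and \<open>c\<close> yields group invertibility of
      \<open>c\<close>.\<close>
    group_invertible_of_bc_invertible[OF assms(2,1)]
    bc_invertible_mult_left bc_invertible_mult_left_cancel
  by blast

end
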